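(* Fix a non-empty finite set $Z$, an involution $\sigma:Z\to Z$, a choice of representative $z_O\in O$ for each non-trivial orbit $O$ of $\sigma$, and a number $K>0$. Let $(Z,\sigma,\kappa)$ be a weighted dual skeleton of degree $K$, and for each non-trivial orbit $O$ define $$r_O:=r_{z_O}=\sqrt{\frac{\kappa(\sigma(z_O))}{\kappa(z_O)}}.$$ Then for each non-trivial orbit $O=\{z_O,\sigma(z_O)\}$ the weight $\kappa$ is determined by $K$ and $r_O$ via $$\kappa(z_O)=\frac{\sqrt K}{r_O},\qquad \kappa(\sigma(z_O))=\sqrt K\,r_O.$$ At a fixed point $z$ of $\sigma$ one necessarily has $\kappa(z)=\sqrt K$ and $r_z=1$. Moreover the map $$\kappa\longmapsto (r_O)_{O\text{ non-trivial orbit}}$$ is a bijection between the set of weights of degree $K$ on $(Z,\sigma)$ and $(\mathbb R_{>0})^k$, where $k$ is the number of non-trivial pairs of $\sigma$.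
   Context: A weighted dual skeleton of degree $K>0$ is a triple $(Z,\sigma,\kappa)$ where $Z$ is a non-empty finite set, $\sigma:Z\to Z$ satisfies $\sigma^2=\mathrm{id}$, and $\kappa:Z\to\mathbb R_{>0}$ satisfies $\kappa(z)\kappa(\sigma(z))=K$ for all $z\in Z$; such a $\kappa$ is called a weight of degree $K$. A non-trivial orbit (non-trivial pair) is an orbit $\{z,\sigma(z)\}$ with $\sigma(z)\ne z$. The orbit ratio at $z\in Z$ is $r_z=(\kappa(\sigma(z))/\kappa(z))^{1/2}$. *)

theory Defs
  imports Complex_Main "HOL-Library.FuncSet"
begin

definition involution_on :: "'a set \<Rightarrow> ('a \<Rightarrow> 'a) \<Rightarrow> bool" where
  "involution_on Z \<sigma> \<longleftrightarrow> \<sigma> \<in> Z \<rightarrow> Z \<and> (\<forall>z\<in>Z. \<sigma> (\<sigma> z) = z)"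

definition is_weight :: "'a set \<Rightarrow> ('a \<Rightarrow> 'a) \<Rightarrow> real \<Rightarrow> ('a \<Rightarrow> real) \<Rightarrow> bool" where
  "is_weight Z \<sigma> K \<kappa> \<longleftrightarrow> (\<forall>z\<in>Z. 0 < \<kappa> z) \<and> (\<forall>z\<in>Z. \<kappa> z * \<kappa> (\<sigma> z) = K)"

definition weighted_dual_skeleton :: "'a set \<Rightarrow> ('a \<Rightarrow> 'a) \<Rightarrow> real \<Rightarrow> ('a \<Rightarrow> real) \<Rightarrow> bool" where
  "weighted_dual_skeleton Z \<sigma> K \<kappa> \<longleftrightarrow>
     0 < K \<and> finite Z \<and> Z \<noteq> {} \<and> involution_on Z \<sigma> \<and> is_weight Z \<sigma> K \<kappa>"

text \<open>
  Functions are total in HOL, so a weight, being a function with domain Z, is represented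
  uniquely by its extensional version (value \<^term>\<open>undefined\<close> outside Z).
\<close>
definition weights :: "'a set \<Rightarrow> ('a \<Rightarrow> 'a) \<Rightarrow> real \<Rightarrow> ('a \<Rightarrow> real) set" where
  "weights Z \<sigma> K = {\<kappa> \<in> extensional Z. is_weight Z \<sigma> K \<kappa>}"

definition nontrivial_orbits :: "'a set \<Rightarrow> ('a \<Rightarrow> 'a) \<Rightarrow> 'a set set" where
  "nontrivial_orbits Z \<sigma> = {{z, \<sigma> z} | z. z \<in> Z \<and> \<sigma> z \<noteq> z}"

definition orbit_ratio :: "('a \<Rightarrow> 'a) \<Rightarrow> ('a \<Rightarrow> real) \<Rightarrow> 'a \<Rightarrow> real" where
  "orbit_ratio \<sigma> \<kappa> z = sqrt (\<kappa> (\<sigma> z) / \<kappa> z)"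

end

theory Submission
  imports Defs
begin

text \<open>
  On a pair \<open>z\<close>, \<open>\<sigma> z\<close> the two positive values \<open>a = \<kappa> z\<close> and \<open>b = \<kappa> (\<sigma> z)\<close> are subject to
  the single equation \<open>a b = K\<close>, so one positive number describes them, and the square root
  \<open>\<rho>\<close> of the quotient \<open>b / a\<close> is such a coordinate: \<open>\<surd>K = \<surd>a \<surd>b\<close> and \<open>\<rho> = \<surd>b / \<surd>a\<close> give
  \<open>\<surd>K / \<rho> = a\<close> and \<open>\<surd>K \<rho> = b\<close> (lemma \<open>weight_eq_sqrt_orbit_ratio\<close>).  At a fixed point \<open>\<rho> = 1\<close>,
  so the same formula forces the value \<open>\<surd>K\<close> and there is no freedom.

  Equations at different orbits involve different values of \<open>\<kappa>\<close>, so the ratios can be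
  prescribed independently on the non-trivial orbits.  The formulas above, read as a definition
  of \<open>\<kappa>\<close>, produce the inverse of the ratio map (\<open>weight_of_ratios\<close>, \<open>bij_betw_orbit_ratios\<close>).
  An enumeration of the orbits then merely relabels the coordinates
  (\<open>bij_betw_PiE_reindex\<close>).
\<close>

text \<open>
  Both formulas come from \<open>\<surd>K = \<surd>(\<kappa> z) \<surd>(\<kappa> (\<sigma> z))\<close>.  They hold at every point, not just at
  representatives; fixed points are the case of ratio \<open>1\<close>.
\<close>
lemma weight_eq_sqrt_orbit_ratio:
  assumes "involution_on Z \<sigma>" "is_weight Z \<sigma> K \<kappa>" "z \<in> Z"
  shows "\<kappa> z = sqrt K / orbit_ratio \<sigma> \<kappa> z"
    and "\<kappa> (\<sigma> z) = sqrt K * orbit_ratio \<sigma> \<kappa> z"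
    and "0 < orbit_ratio \<sigma> \<kappa> z"
proof -
  have "\<sigma> z \<in> Z" using assms by (auto simp: involution_on_def)
  then have pos: "0 < \<kappa> z" "0 < \<kappa> (\<sigma> z)" and K: "K = \<kappa> z * \<kappa> (\<sigma> z)"
    using assms by (auto simp: is_weight_def)
  then show "\<kappa> z = sqrt K / orbit_ratio \<sigma> \<kappa> z"
    and "\<kappa> (\<sigma> z) = sqrt K * orbit_ratio \<sigma> \<kappa> z"
    and "0 < orbit_ratio \<sigma> \<kappa> z"
    by (auto simp: orbit_ratio_def real_sqrt_mult real_sqrt_divide)
qed

lemma weight_at_fixed_point:
  assumes "involution_on Z \<sigma>" "is_weight Z \<sigma> K \<kappa>" "z \<in> Z" "\<sigma> z = z"
  shows "\<kappa> z = sqrt K" and "orbit_ratio \<sigma> \<kappa> z = 1"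
proof -
  have "\<kappa> z \<noteq> 0" using assms by (auto simp: is_weight_def)
  then show ratio: "orbit_ratio \<sigma> \<kappa> z = 1" using assms by (simp add: orbit_ratio_def)
  show "\<kappa> z = sqrt K" using weight_eq_sqrt_orbit_ratio(1)[OF assms(1-3)] ratio by simp
qed

lemma nontrivial_orbit_representative:
  assumes "involution_on Z \<sigma>" "Q \<in> nontrivial_orbits Z \<sigma>" "w \<in> Q"
  shows "w \<in> Z" and "\<sigma> w \<noteq> w" and "Q = {w, \<sigma> w}"
  using assms by (auto simp: nontrivial_orbits_def involution_on_def)

text \<open>
  The restriction to \<^term>\<open>Z\<close> makes the result extensional, so that it is the unique
  representative of its values on \<^term>\<open>Z\<close>.
\<close>
definition weight_of_ratios ::
    "'a set \<Rightarrow> ('a \<Rightarrow> 'a) \<Rightarrow> ('a set \<Rightarrow> 'a) \<Rightarrow> real \<Rightarrow> ('a set \<Rightarrow> real) \<Rightarrow> 'a \<Rightarrow> real" where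
  "weight_of_ratios Z \<sigma> rep K s = (\<lambda>z\<in>Z.
     if \<sigma> z = z then sqrt K
     else if rep {z, \<sigma> z} = z then sqrt K / s {z, \<sigma> z}
     else sqrt K * s {z, \<sigma> z})"

lemma weight_of_ratios_in_weights:
  assumes inv: "involution_on Z \<sigma>"
    and rep: "\<forall>Q \<in> nontrivial_orbits Z \<sigma>. rep Q \<in> Q"
    and "0 < K" and s: "s \<in> nontrivial_orbits Z \<sigma> \<rightarrow>\<^sub>E {0<..}"
  shows "weight_of_ratios Z \<sigma> rep K s \<in> weights Z \<sigma> K"
proof -
  have "0 < weight_of_ratios Z \<sigma> rep K s z \<and>
        weight_of_ratios Z \<sigma> rep K s z * weight_of_ratios Z \<sigma> rep K s (\<sigma> z) = K"
    if z: "z \<in> Z" for z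
  proof (cases "\<sigma> z = z")
    case True
    then show ?thesis using z \<open>0 < K\<close> by (simp add: weight_of_ratios_def)
  next
    case False
    let ?Q = "{z, \<sigma> z}"
    have Q: "?Q \<in> nontrivial_orbits Z \<sigma>" using z False by (auto simp: nontrivial_orbits_def)
    have sQ: "0 < s ?Q" using PiE_mem[OF s Q] by simp
    have \<sigma>z: "\<sigma> z \<in> Z" "\<sigma> (\<sigma> z) = z" using inv z by (auto simp: involution_on_def)
    have swap: "{\<sigma> z, z} = ?Q" by auto
    \<comment> \<open>Exactly one point of the pair is the representative, so one factor carries \<open>s\<close> and the
        other \<open>1 / s\<close>.\<close>
    have "rep ?Q = z \<or> rep ?Q = \<sigma> z" using rep Q by auto
    then show ?thesis
      using z \<sigma>z sQ False False[symmetric] \<open>0 < K\<close> by (auto simp: weight_of_ratios_def swap)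
  qed
  then show ?thesis by (auto simp: weights_def is_weight_def weight_of_ratios_def)
qed

lemma orbit_ratio_weight_of_ratios:
  assumes inv: "involution_on Z \<sigma>"
    and rep: "\<forall>Q \<in> nontrivial_orbits Z \<sigma>. rep Q \<in> Q"
    and "0 < K" and s: "s \<in> nontrivial_orbits Z \<sigma> \<rightarrow>\<^sub>E {0<..}"
    and Q: "Q \<in> nontrivial_orbits Z \<sigma>"
  shows "orbit_ratio \<sigma> (weight_of_ratios Z \<sigma> rep K s) (rep Q) = s Q"
proof -
  let ?w = "rep Q"
  have w: "?w \<in> Z" "\<sigma> ?w \<noteq> ?w" "{?w, \<sigma> ?w} = Q" "{\<sigma> ?w, ?w} = Q"
    using nontrivial_orbit_representative[OF inv Q] rep Q by auto
  have \<sigma>w: "\<sigma> ?w \<in> Z" "\<sigma> (\<sigma> ?w) = ?w" using inv w by (auto simp: involution_on_def)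
  have "0 < s Q" using PiE_mem[OF s Q] by simp
  moreover have "weight_of_ratios Z \<sigma> rep K s ?w = sqrt K / s Q"
    using w by (simp add: weight_of_ratios_def)
  moreover have "weight_of_ratios Z \<sigma> rep K s (\<sigma> ?w) = sqrt K * s Q"
    using w w(2)[symmetric] \<sigma>w by (simp add: weight_of_ratios_def)
  ultimately show ?thesis using \<open>0 < K\<close> by (simp add: orbit_ratio_def)
qed

text \<open>
  Injectivity of the ratio map: every non-fixed point is either the representative of its orbit
  or the partner of that representative, and the ratio at the representative determines the
  weight at both.
\<close>
lemma weight_of_ratios_orbit_ratio:
  assumes inv: "involution_on Z \<sigma>"
    and rep: "\<forall>Q \<in> nontrivial_orbits Z \<sigma>. rep Q \<in> Q"
    and \<kappa>: "\<kappa> \<in> weights Z \<sigma> K"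
  shows "weight_of_ratios Z \<sigma> rep K
           (\<lambda>Q \<in> nontrivial_orbits Z \<sigma>. orbit_ratio \<sigma> \<kappa> (rep Q)) = \<kappa>"
proof (rule extensionalityI[where A = Z])
  show "weight_of_ratios Z \<sigma> rep K
          (\<lambda>Q \<in> nontrivial_orbits Z \<sigma>. orbit_ratio \<sigma> \<kappa> (rep Q)) \<in> extensional Z"
    by (simp add: weight_of_ratios_def)
  show "\<kappa> \<in> extensional Z" using \<kappa> by (simp add: weights_def)
  have wt: "is_weight Z \<sigma> K \<kappa>" using \<kappa> by (simp add: weights_def)
  fix z assume z: "z \<in> Z"
  show "weight_of_ratios Z \<sigma> rep K
          (\<lambda>Q \<in> nontrivial_orbits Z \<sigma>. orbit_ratio \<sigma> \<kappa> (rep Q)) z = \<kappa> z"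
  proof (cases "\<sigma> z = z")
    case True
    then show ?thesis
      using z weight_at_fixed_point(1)[OF inv wt z] by (simp add: weight_of_ratios_def)
  next
    case False
    let ?Q = "{z, \<sigma> z}"
    have Q: "?Q \<in> nontrivial_orbits Z \<sigma>" using z False by (auto simp: nontrivial_orbits_def)
    have \<sigma>z: "\<sigma> z \<in> Z" "\<sigma> (\<sigma> z) = z" using inv z by (auto simp: involution_on_def)
    consider "rep ?Q = z" | "rep ?Q = \<sigma> z" using rep Q by auto
    then show ?thesis
    proof cases
      case 1
      then show ?thesis
        using z False Q weight_eq_sqrt_orbit_ratio(1)[OF inv wt z]
        by (simp add: weight_of_ratios_def)
    next
      case 2
      then show ?thesis
        using z False Q \<sigma>z weight_eq_sqrt_orbit_ratio(2)[OF inv wt \<sigma>z(1)]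
        by (simp add: weight_of_ratios_def)
    qed
  qed
qed

lemma bij_betw_orbit_ratios:
  assumes inv: "involution_on Z \<sigma>"
    and rep: "\<forall>Q \<in> nontrivial_orbits Z \<sigma>. rep Q \<in> Q"
    and "0 < K"
  shows "bij_betw (\<lambda>\<kappa>. \<lambda>Q \<in> nontrivial_orbits Z \<sigma>. orbit_ratio \<sigma> \<kappa> (rep Q))
           (weights Z \<sigma> K) (nontrivial_orbits Z \<sigma> \<rightarrow>\<^sub>E {0<..})"
proof (rule bij_betw_byWitness[where f' = "weight_of_ratios Z \<sigma> rep K"])
  show "\<forall>\<kappa> \<in> weights Z \<sigma> K. weight_of_ratios Z \<sigma> rep K
          (\<lambda>Q \<in> nontrivial_orbits Z \<sigma>. orbit_ratio \<sigma> \<kappa> (rep Q)) = \<kappa>"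
    using weight_of_ratios_orbit_ratio[OF inv rep] by blast
  show "\<forall>s \<in> nontrivial_orbits Z \<sigma> \<rightarrow>\<^sub>E {0<..}. (\<lambda>Q \<in> nontrivial_orbits Z \<sigma>.
          orbit_ratio \<sigma> (weight_of_ratios Z \<sigma> rep K s) (rep Q)) = s"
  proof
    fix s :: "'a set \<Rightarrow> real" assume s: "s \<in> nontrivial_orbits Z \<sigma> \<rightarrow>\<^sub>E {0<..}"
    show "(\<lambda>Q \<in> nontrivial_orbits Z \<sigma>.
             orbit_ratio \<sigma> (weight_of_ratios Z \<sigma> rep K s) (rep Q)) = s"
      using s orbit_ratio_weight_of_ratios[OF inv rep \<open>0 < K\<close> s]
      by (intro extensionalityI[where A = "nontrivial_orbits Z \<sigma>"]) (auto simp: PiE_def)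
  qed
  show "(\<lambda>\<kappa>. \<lambda>Q \<in> nontrivial_orbits Z \<sigma>. orbit_ratio \<sigma> \<kappa> (rep Q)) ` weights Z \<sigma> K
          \<subseteq> nontrivial_orbits Z \<sigma> \<rightarrow>\<^sub>E {0<..}"
    using weight_eq_sqrt_orbit_ratio(3)[OF inv] nontrivial_orbit_representative(1)[OF inv] rep
    by (fastforce simp: weights_def)
  show "weight_of_ratios Z \<sigma> rep K ` (nontrivial_orbits Z \<sigma> \<rightarrow>\<^sub>E {0<..}) \<subseteq> weights Z \<sigma> K"
    using weight_of_ratios_in_weights[OF inv rep \<open>0 < K\<close>] by blast
qed

lemma bij_betw_PiE_reindex:
  assumes e: "bij_betw e I J"
  shows "bij_betw (\<lambda>s. \<lambda>i\<in>I. s (e i)) (J \<rightarrow>\<^sub>E A) (I \<rightarrow>\<^sub>E A)"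
proof (rule bij_betw_byWitness[where f' = "\<lambda>t. \<lambda>j\<in>J. t (inv_into I e j)"])
  have e_in: "e i \<in> J" if "i \<in> I" for i using e that by (auto dest: bij_betwE)
  have inv_in: "inv_into I e j \<in> I" if "j \<in> J" for j
    using bij_betw_inv_into[OF e] that by (auto dest: bij_betwE)
  show "\<forall>s \<in> J \<rightarrow>\<^sub>E A. (\<lambda>j\<in>J. (\<lambda>i\<in>I. s (e i)) (inv_into I e j)) = s"
    using inv_in bij_betw_inv_into_right[OF e]
    by (auto simp: PiE_def intro!: extensionalityI[where A = J])
  show "\<forall>t \<in> I \<rightarrow>\<^sub>E A. (\<lambda>i\<in>I. (\<lambda>j\<in>J. t (inv_into I e j)) (e i)) = t"
    using e_in bij_betw_inv_into_left[OF e]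
    by (auto simp: PiE_def intro!: extensionalityI[where A = I])
  show "(\<lambda>s. \<lambda>i\<in>I. s (e i)) ` (J \<rightarrow>\<^sub>E A) \<subseteq> I \<rightarrow>\<^sub>E A" using e_in by auto
  show "(\<lambda>t. \<lambda>j\<in>J. t (inv_into I e j)) ` (I \<rightarrow>\<^sub>E A) \<subseteq> J \<rightarrow>\<^sub>E A" using inv_in by auto
qed

theorem proposition3p1:
  fixes Z :: "'a set" and \<sigma> :: "'a \<Rightarrow> 'a" and rep :: "'a set \<Rightarrow> 'a" and K :: real
  assumes "finite Z" and "Z \<noteq> {}" and "involution_on Z \<sigma>"
    and "\<forall>Q \<in> nontrivial_orbits Z \<sigma>. rep Q \<in> Q"
    and "0 < K"
  defines "r \<equiv> \<lambda>\<kappa> Q. orbit_ratio \<sigma> \<kappa> (rep Q)"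
    and "k \<equiv> card (nontrivial_orbits Z \<sigma>)"
  shows "(\<forall>\<kappa>. weighted_dual_skeleton Z \<sigma> K \<kappa> \<longrightarrow>
            (\<forall>Q \<in> nontrivial_orbits Z \<sigma>.
                Q = {rep Q, \<sigma> (rep Q)} \<and>
                \<kappa> (rep Q) = sqrt K / r \<kappa> Q \<and>
                \<kappa> (\<sigma> (rep Q)) = sqrt K * r \<kappa> Q) \<and>
            (\<forall>z \<in> Z. \<sigma> z = z \<longrightarrow> \<kappa> z = sqrt K \<and> orbit_ratio \<sigma> \<kappa> z = 1)) \<and>
         bij_betw (\<lambda>\<kappa>. \<lambda>Q \<in> nontrivial_orbits Z \<sigma>. r \<kappa> Q)
            (weights Z \<sigma> K) (nontrivial_orbits Z \<sigma> \<rightarrow>\<^sub>E {0<..}) \<and>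
         (\<forall>e. bij_betw e {..<k} (nontrivial_orbits Z \<sigma>) \<longrightarrow>
            bij_betw (\<lambda>\<kappa>. \<lambda>i \<in> {..<k}. r \<kappa> (e i))
              (weights Z \<sigma> K) ({..<k} \<rightarrow>\<^sub>E {0<..}))"
proof (intro conjI allI impI ballI)
  note inv = \<open>involution_on Z \<sigma>\<close>
  fix \<kappa> assume "weighted_dual_skeleton Z \<sigma> K \<kappa>"
  then have wt: "is_weight Z \<sigma> K \<kappa>" by (simp add: weighted_dual_skeleton_def)
  {
    fix Q assume Q: "Q \<in> nontrivial_orbits Z \<sigma>"
    have repQ: "rep Q \<in> Q" using assms(4) Q by blast
    show "Q = {rep Q, \<sigma> (rep Q)}" by (rule nontrivial_orbit_representative(3)[OF inv Q repQ])
    have "rep Q \<in> Z" by (rule nontrivial_orbit_representative(1)[OF inv Q repQ])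
    then show "\<kappa> (rep Q) = sqrt K / r \<kappa> Q" and "\<kappa> (\<sigma> (rep Q)) = sqrt K * r \<kappa> Q"
      unfolding r_def by (fact weight_eq_sqrt_orbit_ratio[OF inv wt])+
  next
    fix z assume "z \<in> Z" "\<sigma> z = z"
    then show "\<kappa> z = sqrt K" and "orbit_ratio \<sigma> \<kappa> z = 1"
      by (fact weight_at_fixed_point[OF inv wt])+
  }
next
  show ratios: "bij_betw (\<lambda>\<kappa>. \<lambda>Q \<in> nontrivial_orbits Z \<sigma>. r \<kappa> Q)
            (weights Z \<sigma> K) (nontrivial_orbits Z \<sigma> \<rightarrow>\<^sub>E {0<..})"
    unfolding r_def by (rule bij_betw_orbit_ratios[OF assms(3-5)])
  fix e assume e: "bij_betw e {..<k} (nontrivial_orbits Z \<sigma>)"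
  have "(\<lambda>s. \<lambda>i \<in> {..<k}. s (e i)) \<circ> (\<lambda>\<kappa>. \<lambda>Q \<in> nontrivial_orbits Z \<sigma>. r \<kappa> Q)
          = (\<lambda>\<kappa>. \<lambda>i \<in> {..<k}. r \<kappa> (e i))"
    using bij_betwE[OF e] by (auto simp: fun_eq_iff restrict_def)
  then show "bij_betw (\<lambda>\<kappa>. \<lambda>i \<in> {..<k}. r \<kappa> (e i))
              (weights Z \<sigma> K) ({..<k} \<rightarrow>\<^sub>E {0<..})"
    using bij_betw_trans[OF ratios bij_betw_PiE_reindex[OF e]] by simp
qed

end
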